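(* Let $\mathcal{A}$ be a finite set of chords of a fixed circle such that the circle graph $G(\mathcal{A})$ does not contain $K_4$ as a subgraph. Then $G(\mathcal{A})$ admits a proper coloring with at most $30$ colors; that is, $\chi(G(\mathcal{A}))\le 30$.
   Context: Fix a circle. For a finite set $\mathcal{A}$ of chords of this circle, the circle graph $G(\mathcal{A})$ has vertex set $\mathcal{A}$, and two chords are adjacent if and only if they have a common inner point (i.e. they cross). A proper coloring of a graph assigns colors to vertices so that adjacent vertices receive different colors; a coloring of a set of chords means a proper coloring of the corresponding circle graph. *)

theory Defs
  imports "HOL-Analysis.Analysis" "Graph_Theory.Graph_Theory"
begin

definition chord :: "complex \<Rightarrow> real \<Rightarrow> complex set \<Rightarrow> bool" where
  "chord c r X \<longleftrightarrow> (\<exists>a\<in>sphere c r. \<exists>b\<in>sphere c r. a \<noteq> b \<and> X = closed_segment a b)"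

(* The inner points of a chord are those other than its two endpoints, so chords
   that merely share an endpoint do not cross. *)
definition cross :: "complex set \<Rightarrow> complex set \<Rightarrow> bool" where
  "cross X Y \<longleftrightarrow> rel_interior X \<inter> rel_interior Y \<noteq> {}"

(* An undirected simple graph is a loop-free symmetric digraph, as in the locale graph. *)
definition circle_graph :: "complex set set \<Rightarrow> complex set pair_pre_digraph" where
  "circle_graph A =
    \<lparr> pverts = A, parcs = {(X, Y). X \<in> A \<and> Y \<in> A \<and> X \<noteq> Y \<and> cross X Y} \<rparr>"

definition proper_coloring :: "('a, 'b) pre_digraph \<Rightarrow> ('a \<Rightarrow> nat) \<Rightarrow> bool" where
  "proper_coloring G f \<longleftrightarrow> (\<forall>(u, v)\<in>arcs_ends G. f u \<noteq> f v)"

definition colorable :: "('a, 'b) pre_digraph \<Rightarrow> nat \<Rightarrow> bool" where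
  "colorable G k \<longleftrightarrow> (\<exists>f. proper_coloring G f \<and> f ` verts G \<subseteq> {..<k})"

(* Meaningful for finite loop-free graphs, which are colorable with some number of colors. *)
definition chromatic_number :: "('a, 'b) pre_digraph \<Rightarrow> nat" where
  "chromatic_number G = (LEAST k. colorable G k)"

lemma rel_interior_chord:
  assumes "chord c r X"
  shows "rel_interior X = X \<inter> ball c r"
proof -
  obtain a b where ab: "a \<in> sphere c r" "b \<in> sphere c r" "a \<noteq> b" "X = closed_segment a b"
    using assms by (auto simp: chord_def)
  have "x \<in> ball c r" if "x \<in> open_segment a b" for x
    using dist_decreases_open_segment[OF that, of c] ab(1,2) by auto
  then show ?thesis
    using ab by (auto simp: rel_interior_closed_segment open_segment_def)
qed

lemma pair_graph_circle_graph:
  assumes "finite A"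
  shows "pair_graph (circle_graph A)"
proof
  show "finite (parcs (circle_graph A))"
    by (rule finite_subset[of _ "A \<times> A"]) (use assms in \<open>auto simp: circle_graph_def\<close>)
qed (use assms in \<open>auto simp: circle_graph_def cross_def sym_def symmetric_def\<close>)

end

theory Submission
  imports Defs
begin

text \<open>Let all cliques have at most \<open>k\<close> chords and let \<open>k + 1 \<le> 2 ^ d\<close>; for \<open>k = 3\<close> take \<open>d = 2\<close>. Cut
  the circle open, so that chords become intervals and crossing becomes overlapping. Intervals
  through a common point (a pillar) form a permutation graph, which has a proper \<open>k\<close>-coloring.
  Pillars are placed recursively, each carrying one of \<open>d (k + 2)\<close> blocks of \<open>k\<close> colors, and every
  interval takes its color from the oldest pillar that it contains.

  The intervals inside a segment only conflict with those that have exactly one endpoint in the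
  segment. Invariant: these dangling intervals use at most \<open>d (k + 1)\<close> blocks. If they use fewer,
  one further pillar with a fresh block preserves the invariant. Otherwise cut the segment
  greedily into pieces seeing at most \<open>d k\<close> of the blocks each. If more than \<open>k + 1\<close> pieces were
  needed, there would be \<open>k + 1\<close> consecutive places each missing fewer than \<open>d\<close> of the blocks. The
  blocks are linearly ordered by the outer endpoints of their intervals; divide this order into
  \<open>k + 1\<close> windows of \<open>d\<close> blocks. The \<open>i\<close>-th place sees a block of the \<open>i\<close>-th window, and the
  intervals picked in this way form a clique of size \<open>k + 1\<close>. Hence \<open>2 ^ d\<close> pieces suffice. The
  pillars between them form a binary tree of depth \<open>d\<close>, so \<open>d\<close> fresh blocks are enough, one for
  each level, and each piece sees at most \<open>d k + d\<close> blocks.\<close>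

subsection \<open>Heights and dissections\<close>

definition chains_below :: "'a set \<Rightarrow> ('a \<Rightarrow> 'a \<Rightarrow> bool) \<Rightarrow> 'a \<Rightarrow> 'a set set" where
  "chains_below T R x = {C. C \<subseteq> {y \<in> T. R y x} \<and> pairwise (\<lambda>x y. R x y \<or> R y x) C}"

definition chain_height :: "'a set \<Rightarrow> ('a \<Rightarrow> 'a \<Rightarrow> bool) \<Rightarrow> 'a \<Rightarrow> nat" where
  "chain_height T R x = Max (card ` chains_below T R x)"

lemma finite_chains_below: "finite T \<Longrightarrow> finite (chains_below T R x)"
  by (rule finite_subset[of _ "Pow T"]) (auto simp: chains_below_def)

lemma card_le_chain_height:
  assumes "finite T" "C \<in> chains_below T R x"
  shows "card C \<le> chain_height T R x"
  unfolding chain_height_def using assms finite_chains_below[OF assms(1)] by (intro Max_ge) auto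

lemma longest_chain_with_top:
  assumes "finite T" "irreflp_on T R" "x \<in> T"
  obtains C where "C \<subseteq> T" "pairwise (\<lambda>x y. R x y \<or> R y x) C" "card C = Suc (chain_height T R x)"
    "\<forall>y\<in>C. y = x \<or> R y x"
proof -
  have "{} \<in> chains_below T R x"
    by (simp add: chains_below_def)
  then have "chain_height T R x \<in> card ` chains_below T R x"
    unfolding chain_height_def using finite_chains_below[OF assms(1)] by (intro Max_in) auto
  then obtain C where C: "C \<subseteq> {y \<in> T. R y x}" "pairwise (\<lambda>x y. R x y \<or> R y x) C"
    "card C = chain_height T R x"
    by (auto simp: chains_below_def)
  have "x \<notin> C" "finite C"
    using C(1) assms by (auto simp: irreflp_on_def intro: finite_subset)
  show ?thesis
  proof
    show "insert x C \<subseteq> T"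
      using C(1) assms(3) by auto
    show "pairwise (\<lambda>x y. R x y \<or> R y x) (insert x C)"
      using C(1,2) by (auto simp: pairwise_insert)
    show "card (insert x C) = Suc (chain_height T R x)"
      using C(3) \<open>x \<notin> C\<close> \<open>finite C\<close> by simp
    show "\<forall>y\<in>insert x C. y = x \<or> R y x"
      using C(1) by auto
  qed
qed

lemma chain_height_less_if_chains_bounded:
  assumes "finite T" "irreflp_on T R" "x \<in> T"
    and "\<And>C. C \<subseteq> T \<Longrightarrow> pairwise (\<lambda>x y. R x y \<or> R y x) C \<Longrightarrow> card C \<le> k"
  shows "chain_height T R x < k"
  using longest_chain_with_top[OF assms(1-3)] assms(4) by (metis Suc_le_eq)

lemma monotone_on_chain_height:
  assumes "finite T" "transp_on T R" "irreflp_on T R"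
  shows "monotone_on T R (<) (chain_height T R)"
proof (rule monotone_onI)
  fix x y assume xy: "x \<in> T" "y \<in> T" "R x y"
  obtain C where C: "C \<subseteq> T" "pairwise (\<lambda>x y. R x y \<or> R y x) C"
    "card C = Suc (chain_height T R x)" "\<forall>z\<in>C. z = x \<or> R z x"
    using longest_chain_with_top[OF assms(1,3) xy(1)] .
  have "\<forall>z\<in>C. R z y"
    using C(1,4) xy assms(2) by (metis subsetD transp_onD)
  then have "C \<in> chains_below T R y"
    using C(1,2) by (auto simp: chains_below_def)
  then show "chain_height T R x < chain_height T R y"
    using card_le_chain_height[OF assms(1)] C(3) by fastforce
qed

lemma strict_total_order_rank:
  assumes "finite T" "transp_on T R" "irreflp_on T R" "totalp_on T R"
  obtains f :: "'a \<Rightarrow> nat" where "inj_on f T" "\<And>x y. x \<in> T \<Longrightarrow> y \<in> T \<Longrightarrow> f x < f y \<longleftrightarrow> R x y"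
proof
  let ?f = "chain_height T R"
  show less_iff: "?f x < ?f y \<longleftrightarrow> R x y" if "x \<in> T" "y \<in> T" for x y
    using that totalp_onD[OF assms(4)] monotone_onD[OF monotone_on_chain_height[OF assms(1-3)]]
    by (metis less_asym)
  show "inj_on ?f T"
    using totalp_onD[OF assms(4)] less_iff by (metis inj_onI less_irrefl)
qed

lemma greedy_dissection:
  fixes P :: "nat \<Rightarrow> nat \<Rightarrow> bool"
  assumes "s \<le> e" "\<And>u. P u u"
  obtains q where "mono q" "q 0 = s" "\<And>i. q i \<le> e" "\<And>i. P (q i) (q (Suc i))"
    "\<And>i. q (Suc i) < e \<Longrightarrow> \<not> P (q i) (Suc (q (Suc i)))"
proof -
  have longest_piece: "\<exists>v\<le>e. u \<le> v \<and> P u v \<and> (v < e \<longrightarrow> \<not> P u (Suc v))" if "u \<le> e" for u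
  proof -
    let ?W = "{v. u \<le> v \<and> v \<le> e \<and> P u v}"
    have fin: "finite ?W" by (rule finite_subset[of _ "{..e}"]) auto
    have "u \<in> ?W" using that assms(2) by simp
    then have "Max ?W \<in> ?W" using fin by (intro Max_in) auto
    moreover have "Suc (Max ?W) \<notin> ?W"
      using Max_ge[OF fin] by (meson Suc_n_not_le_n)
    ultimately show ?thesis by (intro exI[of _ "Max ?W"]) auto
  qed
  have "\<exists>q. \<forall>i. (q i \<le> e \<and> (i = 0 \<longrightarrow> q i = s)) \<and>
      (q i \<le> q (Suc i) \<and> P (q i) (q (Suc i)) \<and> (q (Suc i) < e \<longrightarrow> \<not> P (q i) (Suc (q (Suc i)))))"
    by (rule dependent_nat_choice) (use assms(1) longest_piece in auto)
  then show ?thesis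
    using that by (metis mono_iff_le_Suc)
qed

lemma window_meets_large_subset:
  assumes "distinct zs" "T \<subseteq> set zs" "length zs < card T + d" "i + d \<le> length zs"
  obtains j where "i \<le> j" "j < i + d" "zs ! j \<in> T"
proof -
  let ?W = "(!) zs ` {i..<i + d}"
  have "inj_on ((!) zs) {i..<i + d}"
    using assms(1,4) by (intro inj_on_nth) auto
  then have "card ?W = d" by (simp add: card_image)
  have "?W \<inter> T \<noteq> {}"
  proof
    assume "?W \<inter> T = {}"
    then have "card (?W \<union> T) = d + card T"
      using \<open>card ?W = d\<close> finite_subset[OF assms(2)] by (simp add: card_Un_disjoint)
    moreover have "card (?W \<union> T) \<le> card (set zs)"
      using assms(2,4) by (intro card_mono) auto
    ultimately show False
      using assms(1,3) by (simp add: distinct_card)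
  qed
  then show ?thesis using that by auto
qed

lemma ex_fresh_list:
  fixes D :: "nat set"
  assumes "finite D" "card D + d \<le> N"
  obtains cs where "distinct cs" "length cs = d" "set cs \<subseteq> {..<N} - D"
proof -
  have "d \<le> card ({..<N} - D)"
    using diff_card_le_card_Diff[OF assms(1), of "{..<N}"] assms(2) by simp
  then obtain C where "C \<subseteq> {..<N} - D" "card C = d" "finite C"
    by (rule obtain_subset_with_card_n)
  then show ?thesis
    using that finite_distinct_list[of C] distinct_card by metis
qed

subsection \<open>Interval systems\<close>

definition interleaved :: "'a::linorder \<Rightarrow> 'a \<Rightarrow> 'a \<Rightarrow> 'a \<Rightarrow> bool" where
  "interleaved a b x y \<longleftrightarrow> a < x \<and> x < b \<and> b < y \<or> x < a \<and> a < y \<and> y < b"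

locale interval_system =
  fixes V :: "'a set" and l r :: "'a \<Rightarrow> nat"
  assumes finite_V: "finite V"
    and l_less_r: "I \<in> V \<Longrightarrow> l I < r I"
    and inj_l: "inj_on l V"
    and inj_r: "inj_on r V"
    and l_neq_r: "I \<in> V \<Longrightarrow> J \<in> V \<Longrightarrow> l I \<noteq> r J"
begin

definition overlap :: "'a \<Rightarrow> 'a \<Rightarrow> bool" where
  "overlap I J \<longleftrightarrow> interleaved (l I) (r I) (l J) (r J)"

text \<open>Segments are half-open, \<open>{s..<e}\<close>: a pillar at \<open>q\<close> stands just before position \<open>q\<close>, so it
  never coincides with an endpoint.\<close>

definition stabbed :: "nat \<Rightarrow> 'a set" where
  "stabbed q = {I \<in> V. l I < q \<and> q \<le> r I}"

definition inside :: "nat \<Rightarrow> nat \<Rightarrow> 'a set" where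
  "inside s e = {I \<in> V. s \<le> l I \<and> r I < e}"

definition dangling :: "nat \<Rightarrow> nat \<Rightarrow> 'a set" where
  "dangling s e = {I \<in> V. l I < s \<and> s \<le> r I \<and> r I < e \<or> s \<le> l I \<and> l I < e \<and> e \<le> r I}"

definition inner :: "nat \<Rightarrow> 'a \<Rightarrow> nat" where
  "inner s I = (if s \<le> l I then l I else r I)"

text \<open>The order of the outer endpoints when the outside of the segment is traversed
  circularly, starting from its right end.\<close>

definition outer_before :: "nat \<Rightarrow> 'a \<Rightarrow> 'a \<Rightarrow> bool" where
  "outer_before s I J \<longleftrightarrow>
     (if s \<le> l I then s \<le> l J \<longrightarrow> r I < r J else l J < s \<and> l I < l J)"

definition block_before :: "('a \<Rightarrow> nat) \<Rightarrow> nat \<Rightarrow> nat \<Rightarrow> nat \<Rightarrow> nat \<Rightarrow> bool" where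
  "block_before \<beta> s e x y \<longleftrightarrow>
     (\<forall>I\<in>dangling s e. \<forall>J\<in>dangling s e. \<beta> I = x \<longrightarrow> \<beta> J = y \<longrightarrow> outer_before s I J)"

definition coherent :: "('a \<Rightarrow> nat) \<Rightarrow> nat \<Rightarrow> nat \<Rightarrow> nat list \<Rightarrow> bool" where
  "coherent \<beta> s e zs \<longleftrightarrow>
     distinct zs \<and> \<beta> ` dangling s e \<subseteq> set zs \<and> sorted_wrt (block_before \<beta> s e) zs"

definition seen :: "('a \<Rightarrow> nat) \<Rightarrow> nat \<Rightarrow> nat \<Rightarrow> nat \<Rightarrow> nat \<Rightarrow> nat set" where
  "seen \<beta> s e u v = \<beta> ` (dangling s e \<inter> dangling u v)"

text \<open>How a piece \<open>{u..<v}\<close> relates to \<open>{s..<e}\<close> once pillars with blocks in \<open>B\<close> have cut it off.\<close>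

definition inherits ::
  "nat set \<Rightarrow> ('a \<Rightarrow> nat) \<Rightarrow> nat \<Rightarrow> nat \<Rightarrow> ('a \<Rightarrow> nat) \<Rightarrow> nat \<Rightarrow> nat \<Rightarrow> bool" where
  "inherits B \<beta> s e \<gamma> u v \<longleftrightarrow>
     (\<forall>I\<in>dangling u v. \<gamma> I \<in> B \<or> I \<in> dangling s e \<and> \<gamma> I = \<beta> I)"

definition set_pillar :: "('a \<Rightarrow> nat) \<Rightarrow> nat \<Rightarrow> nat \<Rightarrow> nat \<Rightarrow> nat \<Rightarrow> 'a \<Rightarrow> nat" where
  "set_pillar \<beta> s e q c I = (if I \<in> inside s e \<inter> stabbed q then c else \<beta> I)"

lemma finite_dangling [simp]: "finite (dangling s e)"
  using finite_V by (simp add: dangling_def)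

lemma finite_seen [simp]: "finite (seen \<beta> s e u v)"
  by (simp add: seen_def)

lemma seen_subset_if_coherent: "coherent \<beta> s e zs \<Longrightarrow> seen \<beta> s e u v \<subseteq> set zs"
  by (auto simp: coherent_def seen_def)

lemma dangling_empty_segment [simp]: "dangling s s = {}"
  by (simp add: dangling_def)

lemma distinct_endpoints_if_neq:
  assumes "I \<in> V" "J \<in> V" "I \<noteq> J"
  shows "l I \<noteq> l J" "r I \<noteq> r J" "l I \<noteq> r J" "r I \<noteq> l J"
  using assms inj_l inj_r l_neq_r by (auto simp: inj_on_def dest: sym)

lemma inner_bounds_if_dangling:
  assumes "I \<in> dangling s e" "I \<in> dangling u v" "s \<le> u" "v \<le> e"
  shows "u \<le> inner s I" "inner s I < v"
  using assms l_less_r[of I] by (auto simp: dangling_def inner_def)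

lemma overlap_commute: "overlap I J \<longleftrightarrow> overlap J I"
  by (auto simp: overlap_def interleaved_def)

lemma overlap_if_outer_before:
  assumes "I \<in> dangling s e" "J \<in> dangling s e" "outer_before s I J" "inner s I \<le> inner s J" "I \<noteq> J"
  shows "overlap I J"
proof -
  have "I \<in> V" "J \<in> V" using assms(1,2) by (auto simp: dangling_def)
  then show ?thesis
    using assms distinct_endpoints_if_neq[of I J] l_less_r[of I] l_less_r[of J]
    by (auto simp: dangling_def outer_before_def inner_def overlap_def interleaved_def
        split: if_splits)
qed

lemma inherits_refl: "inherits {} \<beta> s e \<beta> s e"
  by (simp add: inherits_def)

lemma inherits_trans:
  "inherits B \<beta> s e \<gamma> u v \<Longrightarrow> inherits C \<gamma> u v \<delta> x y \<Longrightarrow> inherits (B \<union> C) \<beta> s e \<delta> x y"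
  unfolding inherits_def by (metis UnCI)

lemma image_dangling_if_inherits:
  "inherits B \<beta> s e \<gamma> u v \<Longrightarrow> \<gamma> ` dangling u v \<subseteq> B \<union> seen \<beta> s e u v"
  by (auto simp: inherits_def seen_def)

lemma image_dangling_subset_if_inherits:
  assumes "coherent \<beta> s e zs" "inherits B \<beta> s e \<gamma> u v"
  shows "\<gamma> ` dangling u v \<subseteq> B \<union> set zs"
  using image_dangling_if_inherits[OF assms(2)] seen_subset_if_coherent[OF assms(1), of u v] by auto

lemma card_image_dangling_le:
  assumes "inherits B \<beta> s e \<gamma> u v" "finite B"
  shows "card (\<gamma> ` dangling u v) \<le> card B + card (seen \<beta> s e u v)"
proof -
  have "card (\<gamma> ` dangling u v) \<le> card (B \<union> seen \<beta> s e u v)"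
    using image_dangling_if_inherits[OF assms(1)] assms(2) by (intro card_mono) auto
  also have "\<dots> \<le> card B + card (seen \<beta> s e u v)"
    by (rule card_Un_le)
  finally show ?thesis .
qed

lemma set_pillar_dangling:
  assumes "s \<le> q" "q \<le> e" "(u, v) \<in> {(s, q), (q, e)}" "c \<notin> \<beta> ` dangling s e" "I \<in> dangling u v"
  shows "set_pillar \<beta> s e q c I = c \<longleftrightarrow> I \<in> inside s e"
    and "I \<notin> inside s e \<Longrightarrow> I \<in> dangling s e \<and> set_pillar \<beta> s e q c I = \<beta> I"
  using assms l_less_r[of I]
  by (auto simp: dangling_def inside_def stabbed_def set_pillar_def split: if_splits)

lemma inherits_set_pillar:
  assumes "s \<le> q" "q \<le> e" "(u, v) \<in> {(s, q), (q, e)}" "c \<notin> \<beta> ` dangling s e"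
  shows "inherits {c} \<beta> s e (set_pillar \<beta> s e q c) u v"
  using set_pillar_dangling[OF assms] by (auto simp: inherits_def)

lemma block_before_set_pillar:
  assumes "s \<le> q" "q \<le> e" "(u, v) \<in> {(s, q), (q, e)}" "c \<notin> \<beta> ` dangling s e"
    and "x \<noteq> c" "y \<noteq> c" "block_before \<beta> s e x y"
  shows "block_before (set_pillar \<beta> s e q c) u v x y"
  unfolding block_before_def
proof (intro ballI impI)
  fix I J assume IJ: "I \<in> dangling u v" "J \<in> dangling u v"
    "set_pillar \<beta> s e q c I = x" "set_pillar \<beta> s e q c J = y"
  then have "I \<in> dangling s e" "\<beta> I = x" "J \<in> dangling s e" "\<beta> J = y"
    using set_pillar_dangling[OF assms(1-4) IJ(1)] set_pillar_dangling[OF assms(1-4) IJ(2)]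
      assms(5,6) by auto
  moreover from this have "outer_before s I J"
    using assms(7) by (auto simp: block_before_def)
  ultimately show "outer_before u I J"
    using IJ(1,2) assms(1-3) l_less_r[of I] l_less_r[of J]
    by (auto simp: outer_before_def dangling_def split: if_splits)
qed

lemma block_before_pillar_left:
  assumes "s \<le> q" "q \<le> e" "c \<notin> \<beta> ` dangling s e" "y \<noteq> c"
  shows "block_before (set_pillar \<beta> s e q c) s q c y"
  unfolding block_before_def
proof (intro ballI impI)
  fix I J assume IJ: "I \<in> dangling s q" "J \<in> dangling s q"
    "set_pillar \<beta> s e q c I = c" "set_pillar \<beta> s e q c J = y"
  then have "I \<in> inside s e" "J \<in> dangling s e"
    using set_pillar_dangling[OF assms(1,2) _ assms(3) IJ(1)]
      set_pillar_dangling[OF assms(1,2) _ assms(3) IJ(2)] assms(4) by auto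
  then show "outer_before s I J"
    using IJ(2) assms(1,2) l_less_r[of J] by (auto simp: outer_before_def dangling_def inside_def)
qed

lemma block_before_pillar_right:
  assumes "s \<le> q" "q \<le> e" "c \<notin> \<beta> ` dangling s e" "x \<noteq> c"
  shows "block_before (set_pillar \<beta> s e q c) q e x c"
  unfolding block_before_def
proof (intro ballI impI)
  fix I J assume IJ: "I \<in> dangling q e" "J \<in> dangling q e"
    "set_pillar \<beta> s e q c I = x" "set_pillar \<beta> s e q c J = c"
  then have "I \<in> dangling s e" "J \<in> inside s e"
    using set_pillar_dangling[OF assms(1,2) _ assms(3) IJ(1)]
      set_pillar_dangling[OF assms(1,2) _ assms(3) IJ(2)] assms(4) by auto
  then show "outer_before q I J"
    using IJ(1,2) assms(1,2) l_less_r[of I] by (auto simp: outer_before_def dangling_def inside_def)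
qed

lemma coherent_set_pillar:
  assumes "coherent \<beta> s e zs" "s \<le> q" "q \<le> e" "c \<notin> set zs"
  shows "coherent (set_pillar \<beta> s e q c) s q (c # zs)"
    and "coherent (set_pillar \<beta> s e q c) q e (zs @ [c])"
proof -
  let ?\<gamma> = "set_pillar \<beta> s e q c"
  have fresh: "c \<notin> \<beta> ` dangling s e"
    using assms(1,4) by (auto simp: coherent_def)
  have image: "?\<gamma> ` dangling u v \<subseteq> insert c (set zs)" if "(u, v) \<in> {(s, q), (q, e)}" for u v
    using image_dangling_subset_if_inherits[OF assms(1)]
      inherits_set_pillar[OF assms(2,3) that fresh] by fastforce
  have sorted: "sorted_wrt (block_before ?\<gamma> u v) zs" if "(u, v) \<in> {(s, q), (q, e)}" for u v
    by (rule sorted_wrt_mono_rel[OF block_before_set_pillar[OF assms(2,3) that fresh]])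
      (use assms(1,4) in \<open>auto simp: coherent_def\<close>)
  have "block_before ?\<gamma> s q c y" "block_before ?\<gamma> q e y c" if "y \<in> set zs" for y
  proof -
    have "y \<noteq> c"
      using assms(4) that by auto
    then show "block_before ?\<gamma> s q c y" "block_before ?\<gamma> q e y c"
      using assms(2,3) fresh by (simp_all add: block_before_pillar_left block_before_pillar_right)
  qed
  then show "coherent ?\<gamma> s q (c # zs)" "coherent ?\<gamma> q e (zs @ [c])"
    using image[of s q] image[of q e] sorted[of s q] sorted[of q e] assms(1,4)
    by (auto simp: coherent_def sorted_wrt_append)
qed

lemma coherent_restrict:
  assumes "coherent \<beta> s e zs"
  obtains ws where "coherent \<beta> s e ws" "set ws = \<beta> ` dangling s e"
proof
  let ?ws = "filter (\<lambda>x. x \<in> \<beta> ` dangling s e) zs"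
  show "coherent \<beta> s e ?ws" "set ?ws = \<beta> ` dangling s e"
    using assms by (auto simp: coherent_def sorted_wrt_filter)
qed

lemma overfull_piece_meets_window:
  assumes "coherent \<beta> s e zs" "s \<le> u" "v \<le> e"
    and "length zs < card (seen \<beta> s e u v) + d" "i + d \<le> length zs"
  obtains j I where "i \<le> j" "j < i + d" "I \<in> dangling s e" "\<beta> I = zs ! j"
    "u \<le> inner s I" "inner s I < v"
proof -
  have "distinct zs"
    using assms(1) by (simp add: coherent_def)
  then obtain j where j: "i \<le> j" "j < i + d" "zs ! j \<in> seen \<beta> s e u v"
    using seen_subset_if_coherent[OF assms(1)] assms(4,5) by (rule window_meets_large_subset)
  then obtain I where "I \<in> dangling s e" "I \<in> dangling u v" "\<beta> I = zs ! j"
    by (auto simp: seen_def)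
  then show ?thesis
    using that[of j I] j(1,2) inner_bounds_if_dangling[of I s e u v] assms(2,3) by auto
qed

lemma overlap_if_block_less:
  assumes "coherent \<beta> s e zs" "I \<in> dangling s e" "J \<in> dangling s e"
    and "\<beta> I = zs ! i" "\<beta> J = zs ! j" "i < j" "j < length zs" "inner s I \<le> inner s J"
  shows "I \<noteq> J" and "overlap I J"
proof -
  have "zs ! i \<noteq> zs ! j"
    using assms(1,6,7) by (simp add: coherent_def nth_eq_iff_index_eq)
  then show "I \<noteq> J"
    using assms(4,5) by auto
  have "block_before \<beta> s e (zs ! i) (zs ! j)"
    using assms(1,6,7) by (simp add: coherent_def sorted_wrt_nth_less)
  then have "outer_before s I J"
    using assms(2-5) by (simp add: block_before_def)
  then show "overlap I J"
    using overlap_if_outer_before assms(2,3,8) \<open>I \<noteq> J\<close> by blast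
qed

lemma ex_interval_per_window:
  assumes "coherent \<beta> s e zs" "length zs = d * n" "mono q" "s \<le> q 0" "q n < e"
    and overfull: "\<And>i. i < n \<Longrightarrow> length zs < card (seen \<beta> s e (q i) (Suc (q (Suc i)))) + d"
  shows "\<exists>j F. \<forall>i<n. d * i \<le> j i \<and> j i < d * Suc i \<and> F i \<in> dangling s e \<and> \<beta> (F i) = zs ! j i \<and>
    q i \<le> inner s (F i) \<and> inner s (F i) \<le> q (Suc i)"
proof -
  have "\<exists>j I. d * i \<le> j \<and> j < d * Suc i \<and> I \<in> dangling s e \<and> \<beta> I = zs ! j \<and>
      q i \<le> inner s I \<and> inner s I \<le> q (Suc i)" if i: "i < n" for i
  proof -
    have "s \<le> q i" "Suc (q (Suc i)) \<le> e"
      using assms(3-5) i monoD[of q 0 i] monoD[of q "Suc i" n] by auto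
    moreover have "d * i + d \<le> length zs"
      using mult_le_mono2[of "Suc i" n d] i assms(2) by simp
    ultimately obtain j I where "d * i \<le> j" "j < d * i + d" "I \<in> dangling s e" "\<beta> I = zs ! j"
      "q i \<le> inner s I" "inner s I < Suc (q (Suc i))"
      using overfull_piece_meets_window[OF assms(1) _ _ overfull[OF i]] by blast
    then show ?thesis
      by (intro exI[of _ j] exI[of _ I]) auto
  qed
  then show ?thesis by metis
qed

lemma clique_if_overfull_pieces:
  assumes "coherent \<beta> s e zs" "length zs = d * n" "mono q" "s \<le> q 0" "q n < e"
    and "\<And>i. i < n \<Longrightarrow> length zs < card (seen \<beta> s e (q i) (Suc (q (Suc i)))) + d"
  obtains C where "C \<subseteq> V" "pairwise overlap C" "card C = n"
proof -
  obtain j F where F: "\<forall>i<n. d * i \<le> j i \<and> j i < d * Suc i \<and> F i \<in> dangling s e \<and>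
      \<beta> (F i) = zs ! j i \<and> q i \<le> inner s (F i) \<and> inner s (F i) \<le> q (Suc i)"
    using ex_interval_per_window[OF assms] by blast
  have overlaps: "F i \<noteq> F i'" "overlap (F i) (F i')" if "i < i'" "i' < n" for i i'
  proof -
    have "i < n"
      using that by simp
    then have "j i < d * Suc i" "d * i' \<le> j i'" "j i' < d * Suc i'"
      using F that(2) by auto
    then have "j i < j i'" "j i' < length zs"
      using mult_le_mono2[of "Suc i" i' d] mult_le_mono2[of "Suc i'" n d] that assms(2)
      by linarith+
    moreover have "inner s (F i) \<le> inner s (F i')"
      using F \<open>i < n\<close> that monoD[OF assms(3), of "Suc i" i'] by (metis Suc_leI order_trans)
    ultimately show "F i \<noteq> F i'" "overlap (F i) (F i')"
      using overlap_if_block_less[OF assms(1), of "F i" "F i'" "j i" "j i'"] F \<open>i < n\<close> that(2)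
      by auto
  qed
  show ?thesis
  proof
    show "F ` {..<n} \<subseteq> V"
      using F by (auto simp: dangling_def)
    have "overlap (F i) (F i')" if "i < n" "i' < n" "i \<noteq> i'" for i i'
      using overlaps[of i i'] overlaps[of i' i] overlap_commute that
      by (cases i i' rule: linorder_cases) auto
    then show "pairwise overlap (F ` {..<n})"
      by (auto simp: pairwise_def)
    have "inj_on F {..<n}"
      using overlaps(1) by (intro linorder_inj_onI) auto
    then show "card (F ` {..<n}) = n"
      by (simp add: card_image)
  qed
qed

end

subsection \<open>Extending colorings by pillars\<close>

locale clique_bounded_interval_system = interval_system +
  fixes k :: nat
  assumes card_clique_le: "C \<subseteq> V \<Longrightarrow> pairwise overlap C \<Longrightarrow> card C \<le> k"
begin

text \<open>A color is a pair of a block and a color within the block; of the dangling intervals only the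
  blocks \<open>\<beta>\<close> matter.\<close>

definition extension :: "nat \<Rightarrow> ('a \<Rightarrow> nat) \<Rightarrow> nat \<Rightarrow> nat \<Rightarrow> ('a \<Rightarrow> nat \<times> nat) \<Rightarrow> bool" where
  "extension N \<beta> s e f \<longleftrightarrow>
     (\<forall>I\<in>inside s e. f I \<in> {..<N} \<times> {..<k}) \<and>
     (\<forall>I\<in>inside s e. \<forall>J\<in>inside s e. overlap I J \<longrightarrow> f I \<noteq> f J) \<and>
     (\<forall>I\<in>inside s e. \<forall>J\<in>dangling s e. overlap I J \<longrightarrow> fst (f I) \<noteq> \<beta> J)"

definition extendable :: "nat \<Rightarrow> ('a \<Rightarrow> nat) \<Rightarrow> nat \<Rightarrow> nat \<Rightarrow> bool" where
  "extendable N \<beta> s e \<longleftrightarrow> (\<exists>f. extension N \<beta> s e f)"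

definition glue ::
  "nat \<Rightarrow> ('a \<Rightarrow> nat \<times> nat) \<Rightarrow> ('a \<Rightarrow> nat \<times> nat) \<Rightarrow> ('a \<Rightarrow> nat \<times> nat) \<Rightarrow> 'a \<Rightarrow> nat \<times> nat" where
  "glue q f h g I = (if r I < q then f I else if q \<le> l I then g I else h I)"

lemma stabbed_coloring:
  obtains h :: "'a \<Rightarrow> nat" where "\<And>I. I \<in> stabbed q \<Longrightarrow> h I < k"
    "\<And>I J. I \<in> stabbed q \<Longrightarrow> J \<in> stabbed q \<Longrightarrow> overlap I J \<Longrightarrow> h I \<noteq> h J"
proof -
  define R where "R I J \<longleftrightarrow> l I < l J \<and> r I < r J" for I J
  have overlap_iff: "overlap I J \<longleftrightarrow> R I J \<or> R J I" if "I \<in> stabbed q" "J \<in> stabbed q" for I J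
    using that by (auto simp: R_def overlap_def interleaved_def stabbed_def)
  have finite: "finite (stabbed q)"
    using finite_V by (simp add: stabbed_def)
  have order: "transp_on (stabbed q) R" "irreflp_on (stabbed q) R"
    by (auto simp: R_def transp_on_def irreflp_on_def)
  have "card C \<le> k" if C: "C \<subseteq> stabbed q" "pairwise (\<lambda>I J. R I J \<or> R J I) C" for C
  proof (rule card_clique_le)
    show "C \<subseteq> V" using C(1) by (auto simp: stabbed_def)
    show "pairwise overlap C"
      using C overlap_iff unfolding pairwise_def by (meson subsetD)
  qed
  then have height: "chain_height (stabbed q) R I < k" if "I \<in> stabbed q" for I
    using chain_height_less_if_chains_bounded[OF finite order(2) that] by simp
  have "chain_height (stabbed q) R I \<noteq> chain_height (stabbed q) R J"
    if "I \<in> stabbed q" "J \<in> stabbed q" "overlap I J" for I J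
    using monotone_onD[OF monotone_on_chain_height[OF finite order]] overlap_iff that
    by (metis less_irrefl)
  with height show ?thesis
    by (rule that)
qed

lemma glue_stabbed: "I \<in> stabbed q \<Longrightarrow> glue q f h g I = h I"
  by (auto simp: glue_def stabbed_def)

lemma glue_not_stabbed_cases:
  assumes "I \<in> inside s e - stabbed q"
  obtains "I \<in> inside s q" "glue q f h g I = f I" | "I \<in> inside q e" "glue q f h g I = g I"
  using assms l_less_r[of I] by (fastforce simp: glue_def inside_def stabbed_def)

lemma fst_glue_neq:
  assumes "s \<le> q" "q \<le> e" "extension N \<gamma> s q f" "extension N \<gamma> q e g"
    and "I \<in> inside s e - stabbed q" "J \<in> dangling s e \<union> inside s e \<inter> stabbed q" "overlap I J"
  shows "fst (glue q f h g I) \<noteq> \<gamma> J"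
proof -
  have "I \<in> inside s q \<Longrightarrow> J \<in> dangling s q" "I \<in> inside q e \<Longrightarrow> J \<in> dangling q e"
    using assms(1,2,6,7)
    by (auto simp: dangling_def inside_def stabbed_def overlap_def interleaved_def)
  with assms(5) show ?thesis
    by (cases rule: glue_not_stabbed_cases[where f = f and g = g and h = h])
      (use assms(3,4,7) in \<open>auto simp: extension_def\<close>)
qed

lemma glue_neq_if_neither_stabbed:
  assumes "extension N \<gamma> s q f" "extension N \<gamma> q e g"
    and "I \<in> inside s e - stabbed q" "J \<in> inside s e - stabbed q" "overlap I J"
  shows "glue q f h g I \<noteq> glue q f h g J"
proof -
  have "\<not> (I \<in> inside s q \<and> J \<in> inside q e)" "\<not> (J \<in> inside s q \<and> I \<in> inside q e)"
    using assms(5) by (auto simp: overlap_def interleaved_def inside_def)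
  then show ?thesis
    using glue_not_stabbed_cases[OF assms(3)] glue_not_stabbed_cases[OF assms(4)] assms(1,2,5)
    unfolding extension_def by metis
qed

lemma glue_neq_if_overlap:
  assumes "s \<le> q" "q \<le> e"
    and f: "extension N (set_pillar \<beta> s e q c) s q f"
    and g: "extension N (set_pillar \<beta> s e q c) q e g"
    and h: "\<And>I J. I \<in> stabbed q \<Longrightarrow> J \<in> stabbed q \<Longrightarrow> overlap I J \<Longrightarrow> h I \<noteq> h J"
    and IJ: "I \<in> inside s e" "J \<in> inside s e" "overlap I J"
  shows "glue q f (\<lambda>I. (c, h I)) g I \<noteq> glue q f (\<lambda>I. (c, h I)) g J"
proof -
  let ?F = "glue q f (\<lambda>I. (c, h I)) g"
  have avoids: "fst (?F I) \<noteq> fst (?F J)"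
    if "I \<in> inside s e - stabbed q" "J \<in> inside s e \<inter> stabbed q" "overlap I J" for I J
    using fst_glue_neq[OF assms(1,2) f g that(1) _ that(3)] that(2)
    by (auto simp: set_pillar_def glue_stabbed)
  show ?thesis
  proof (cases "I \<in> stabbed q"; cases "J \<in> stabbed q")
    assume "I \<in> stabbed q" "J \<in> stabbed q"
    then show ?thesis
      using h IJ(3) by (simp add: glue_stabbed)
  next
    assume "I \<in> stabbed q" "J \<notin> stabbed q"
    then show ?thesis
      using avoids[of J I] IJ overlap_commute by fastforce
  next
    assume "I \<notin> stabbed q" "J \<in> stabbed q"
    then show ?thesis
      using avoids[of I J] IJ by fastforce
  next
    assume "I \<notin> stabbed q" "J \<notin> stabbed q"
    then show ?thesis
      using glue_neq_if_neither_stabbed[OF f g] IJ by simp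
  qed
qed

lemma extension_glue:
  assumes "s \<le> q" "q \<le> e" "c < N" "c \<notin> \<beta> ` dangling s e"
    and f: "extension N (set_pillar \<beta> s e q c) s q f"
    and g: "extension N (set_pillar \<beta> s e q c) q e g"
    and h: "\<And>I. I \<in> stabbed q \<Longrightarrow> h I < k"
      "\<And>I J. I \<in> stabbed q \<Longrightarrow> J \<in> stabbed q \<Longrightarrow> overlap I J \<Longrightarrow> h I \<noteq> h J"
  shows "extension N \<beta> s e (glue q f (\<lambda>I. (c, h I)) g)"
proof -
  let ?F = "glue q f (\<lambda>I. (c, h I)) g"
  have "?F I \<in> {..<N} \<times> {..<k}" if "I \<in> inside s e" for I
  proof (cases "I \<in> stabbed q")
    case True
    then show ?thesis
      using assms(3) h(1) by (simp add: glue_stabbed)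
  next
    case False
    then show ?thesis
      using that f g glue_not_stabbed_cases[of I s e q] unfolding extension_def by (metis DiffI)
  qed
  moreover have "fst (?F I) \<noteq> \<beta> J" if "I \<in> inside s e" "J \<in> dangling s e" "overlap I J" for I J
  proof (cases "I \<in> stabbed q")
    case True
    then show ?thesis
      using assms(4) that(2) by (auto simp: glue_stabbed)
  next
    case False
    moreover have "set_pillar \<beta> s e q c J = \<beta> J"
      using that(2) by (auto simp: dangling_def inside_def set_pillar_def)
    ultimately show ?thesis
      using fst_glue_neq[OF assms(1,2) f g, of I J] that by simp
  qed
  ultimately show ?thesis
    unfolding extension_def using glue_neq_if_overlap[where h = h, OF assms(1,2) f g h(2)] by blast
qed

lemma extendable_set_pillar:
  assumes "s \<le> q" "q \<le> e" "c < N" "c \<notin> \<beta> ` dangling s e"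
    and "extendable N (set_pillar \<beta> s e q c) s q" "extendable N (set_pillar \<beta> s e q c) q e"
  shows "extendable N \<beta> s e"
  using assms(5,6) extension_glue[OF assms(1-4)] stabbed_coloring[of q]
  unfolding extendable_def by metis

lemma extendable_by_pillar:
  assumes "coherent \<beta> s e zs" "s \<le> q" "q \<le> e" "c < N" "c \<notin> set zs"
    and parts: "\<And>\<gamma> u v xs. (u, v) \<in> {(s, q), (q, e)} \<Longrightarrow> coherent \<gamma> u v xs \<Longrightarrow>
      inherits {c} \<beta> s e \<gamma> u v \<Longrightarrow> extendable N \<gamma> u v"
  shows "extendable N \<beta> s e"
proof -
  let ?\<gamma> = "set_pillar \<beta> s e q c"
  have fresh: "c \<notin> \<beta> ` dangling s e"
    using assms(1,5) by (auto simp: coherent_def)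
  have "extendable N ?\<gamma> u v" if "(u, v) \<in> {(s, q), (q, e)}" for u v
    using parts[OF that _ inherits_set_pillar[OF assms(2,3) that fresh]]
      coherent_set_pillar[OF assms(1-3,5)] that by auto
  then show ?thesis
    using assms(2-4) fresh by (intro extendable_set_pillar[of s q e c]) auto
qed

text \<open>All pillars on level \<open>i\<close> of the binary tree carry the block \<open>cs ! i\<close>.\<close>

lemma extendable_by_pillar_tree:
  assumes "coherent \<beta> s e zs" "mono q" "q 0 = s" "q (2 ^ length cs) = e"
    and "distinct cs" "set cs \<subseteq> {..<N}" "set cs \<inter> set zs = {}"
    and "\<And>i \<gamma> xs. i < 2 ^ length cs \<Longrightarrow> coherent \<gamma> (q i) (q (Suc i)) xs \<Longrightarrow>
      inherits (set cs) \<beta> s e \<gamma> (q i) (q (Suc i)) \<Longrightarrow> extendable N \<gamma> (q i) (q (Suc i))"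
  shows "extendable N \<beta> s e"
  using assms
proof (induction cs arbitrary: \<beta> s e zs q)
  case Nil
  then show ?case
    using Nil.prems(8)[of 0 \<beta> zs] inherits_refl by simp
next
  case (Cons c cs)
  let ?m = "2 ^ length cs"
  have le: "s \<le> q ?m" "q ?m \<le> e"
    using monoD[OF Cons.prems(2)] Cons.prems(3,4) by auto
  have fresh: "c < N" "c \<notin> set zs" "c \<notin> set cs"
    using Cons.prems(5-7) by auto
  show ?case
  proof (rule extendable_by_pillar[OF Cons.prems(1) le fresh(1,2)])
    fix \<gamma> u v xs
    assume half: "(u, v) \<in> {(s, q ?m), (q ?m, e)}" and coh: "coherent \<gamma> u v xs"
      and inh: "inherits {c} \<beta> s e \<gamma> u v"
    obtain ws where ws: "coherent \<gamma> u v ws" "set ws = \<gamma> ` dangling u v"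
      using coherent_restrict[OF coh] .
    have disjoint: "set cs \<inter> set ws = {}"
      using image_dangling_subset_if_inherits[OF Cons.prems(1) inh] ws(2) Cons.prems(7) fresh(3)
      by auto
    have "u = q 0 \<and> v = q (0 + ?m) \<or> u = q ?m \<and> v = q (?m + ?m)"
      using half Cons.prems(3,4) by (auto simp: mult_2)
    then obtain a where a: "a \<le> ?m" "q (a + 0) = u" "q (a + ?m) = v"
      by fastforce
    show "extendable N \<gamma> u v"
    proof (rule Cons.IH[OF ws(1) _ a(2,3) _ _ disjoint])
      fix i \<delta> ys
      assume "i < ?m" and piece: "coherent \<delta> (q (a + i)) (q (a + Suc i)) ys"
        "inherits (set cs) \<gamma> u v \<delta> (q (a + i)) (q (a + Suc i))"
      moreover from this have "a + i < 2 ^ length (c # cs)"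
        using a(1) by simp
      ultimately show "extendable N \<delta> (q (a + i)) (q (a + Suc i))"
        using Cons.prems(8)[of "a + i"] inherits_trans[OF inh piece(2)] by simp
    qed (use Cons.prems(2,5,6) in \<open>auto simp: mono_def\<close>)
  qed
qed

lemma sparse_dissection:
  assumes "coherent \<beta> s e zs" "length zs = d * Suc k" "s \<le> e"
  obtains q where "mono q" "q 0 = s" "\<And>i. Suc k \<le> i \<Longrightarrow> q i = e"
    "\<And>i. card (seen \<beta> s e (q i) (q (Suc i))) \<le> d * k"
proof -
  obtain q where q: "mono q" "q 0 = s" "\<And>i. q i \<le> e"
    "\<And>i. card (seen \<beta> s e (q i) (q (Suc i))) \<le> d * k"
    "\<And>i. q (Suc i) < e \<Longrightarrow> \<not> card (seen \<beta> s e (q i) (Suc (q (Suc i)))) \<le> d * k"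
    using greedy_dissection[OF assms(3), of "\<lambda>u v. card (seen \<beta> s e u v) \<le> d * k"]
    by (auto simp: seen_def)
  have "q (Suc k) = e"
  proof (rule ccontr)
    assume "q (Suc k) \<noteq> e"
    then have "q (Suc k) < e"
      using q(3)[of "Suc k"] by simp
    moreover have "length zs < card (seen \<beta> s e (q i) (Suc (q (Suc i)))) + d" if "i < Suc k" for i
    proof -
      have "q (Suc i) \<le> q (Suc k)"
        using that by (intro monoD[OF q(1)]) simp
      then show ?thesis
        using q(5)[of i] \<open>q (Suc k) < e\<close> assms(2) by simp
    qed
    ultimately obtain C where "C \<subseteq> V" "pairwise overlap C" "card C = Suc k"
      using clique_if_overfull_pieces[OF assms(1,2) q(1)] q(2) by blast
    then show False
      using card_clique_le[of C] by simp
  qed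
  then have "q i = e" if "Suc k \<le> i" for i
    using monoD[OF q(1) that] q(3)[of i] by simp
  then show ?thesis
    using that q(1,2,4) by blast
qed

lemma extendable_by_single_pillar:
  assumes "coherent \<beta> s e zs" "card (\<beta> ` dangling s e) < m" "m \<le> N" "K \<in> inside s e"
    and shorter: "\<And>\<gamma> u v xs. v - u < e - s \<Longrightarrow> u \<le> v \<Longrightarrow> coherent \<gamma> u v xs \<Longrightarrow>
      card (\<gamma> ` dangling u v) \<le> m \<Longrightarrow> extendable N \<gamma> u v"
  shows "extendable N \<beta> s e"
proof -
  let ?D = "\<beta> ` dangling s e"
  obtain ws where ws: "coherent \<beta> s e ws" "set ws = ?D"
    using coherent_restrict[OF assms(1)] .
  have "\<not> {..<N} \<subseteq> ?D"
    using card_mono[of ?D "{..<N}"] assms(2,3) by auto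
  then obtain c where c: "c < N" "c \<notin> set ws"
    using ws(2) by auto
  have K: "s \<le> l K" "l K < r K" "r K < e"
    using assms(4) l_less_r by (auto simp: inside_def)
  show ?thesis
  proof (rule extendable_by_pillar[OF ws(1) _ _ c, of "r K"])
    fix \<gamma> u v xs
    assume uv: "(u, v) \<in> {(s, r K), (r K, e)}"
      and \<gamma>: "coherent \<gamma> u v xs" "inherits {c} \<beta> s e \<gamma> u v"
    have "card (seen \<beta> s e u v) \<le> card ?D"
      by (intro card_mono) (auto simp: seen_def)
    then have "card (\<gamma> ` dangling u v) \<le> m"
      using card_image_dangling_le[OF \<gamma>(2)] assms(2) by simp
    then show "extendable N \<gamma> u v"
      using uv K by (intro shorter[OF _ _ \<gamma>(1)]) auto
  qed (use K in auto)
qed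

lemma extendable_by_sparse_dissection:
  assumes "Suc k \<le> 2 ^ d" "0 < d" "coherent \<beta> s e zs" "s \<le> e"
    and full: "card (\<beta> ` dangling s e) = d * Suc k" and N: "d * (k + 2) \<le> N"
    and shorter: "\<And>\<gamma> u v xs. v - u < e - s \<Longrightarrow> u \<le> v \<Longrightarrow> coherent \<gamma> u v xs \<Longrightarrow>
      card (\<gamma> ` dangling u v) \<le> d * Suc k \<Longrightarrow> extendable N \<gamma> u v"
  shows "extendable N \<beta> s e"
proof -
  let ?D = "\<beta> ` dangling s e"
  obtain ws where ws: "coherent \<beta> s e ws" "set ws = ?D"
    using coherent_restrict[OF assms(3)] .
  then have "length ws = d * Suc k"
    using full by (metis coherent_def distinct_card)
  then obtain q where q: "mono q" "q 0 = s" "\<And>i. Suc k \<le> i \<Longrightarrow> q i = e"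
    "\<And>i. card (seen \<beta> s e (q i) (q (Suc i))) \<le> d * k"
    using sparse_dissection[OF ws(1) _ assms(4)] by metis
  obtain cs where cs: "distinct cs" "length cs = d" "set cs \<subseteq> {..<N} - ?D"
    using ex_fresh_list[of ?D d N] full N by auto
  show ?thesis
  proof (rule extendable_by_pillar_tree[OF ws(1) q(1,2)])
    fix i \<gamma> xs
    let ?u = "q i" and ?v = "q (Suc i)"
    assume \<gamma>: "coherent \<gamma> ?u ?v xs" "inherits (set cs) \<beta> s e \<gamma> ?u ?v"
    have bounds: "s \<le> ?u" "?u \<le> ?v" "?v \<le> e"
      using monoD[OF q(1), of 0 i] monoD[OF q(1), of i "Suc i"]
        monoD[OF q(1), of "Suc i" "Suc i + Suc k"] q(2) q(3)[of "Suc i + Suc k"] by auto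
    have "card (seen \<beta> s e ?u ?v) < card ?D"
      using q(4)[of i] full \<open>0 < d\<close> by simp
    then have "(?u, ?v) \<noteq> (s, e)"
      by (auto simp: seen_def)
    then have "?v - ?u < e - s"
      using bounds by auto
    moreover have "card (\<gamma> ` dangling ?u ?v) \<le> d * Suc k"
      using card_image_dangling_le[OF \<gamma>(2)] q(4)[of i] cs(1,2) by (simp add: distinct_card)
    ultimately show "extendable N \<gamma> ?u ?v"
      using shorter bounds(2) \<gamma>(1) by blast
  qed (use cs ws(2) q(3)[OF assms(1)] in auto)
qed

lemma extendable_if_coherent:
  assumes "Suc k \<le> 2 ^ d" "coherent \<beta> s e zs" "card (\<beta> ` dangling s e) \<le> d * Suc k" "s \<le> e"
  shows "extendable (d * (k + 2)) \<beta> s e"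
  using assms(2-)
proof (induction "e - s" arbitrary: \<beta> s e zs rule: less_induct)
  case less
  consider (empty) "inside s e = {}"
    | (slack) K where "K \<in> inside s e" "card (\<beta> ` dangling s e) < d * Suc k"
    | (full) K where "K \<in> inside s e" "card (\<beta> ` dangling s e) = d * Suc k"
    using less.prems(2) by fastforce
  then show ?case
  proof cases
    case empty
    then show ?thesis
      by (simp add: extendable_def extension_def)
  next
    case slack
    show ?thesis
      using less.hyps
      by (intro extendable_by_single_pillar[OF less.prems(1) slack(2) _ slack(1)]) auto
  next
    case full
    have "card {K} \<le> k"
      using full(1) by (intro card_clique_le) (auto simp: inside_def)
    then have "0 < d"
      using assms(1) by (cases d) auto
    then show ?thesis
      using less.hyps
      by (intro extendable_by_sparse_dissection[OF assms(1) _ less.prems(1,3) full(2)]) auto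
  qed
qed

theorem ex_interval_coloring:
  assumes "Suc k \<le> 2 ^ d"
  shows "\<exists>f :: 'a \<Rightarrow> nat. (\<forall>I\<in>V. f I < d * k * (k + 2)) \<and>
    (\<forall>I\<in>V. \<forall>J\<in>V. overlap I J \<longrightarrow> f I \<noteq> f J)"
proof -
  let ?N = "d * (k + 2)"
  obtain e where e: "\<And>I. I \<in> V \<Longrightarrow> r I < e"
    using finite_V finite_nat_set_iff_bounded[of "r ` V"] by auto
  have dangling: "dangling 0 e = {}"
    using e by (fastforce simp: dangling_def)
  have inside: "inside 0 e = V"
    using e by (auto simp: inside_def)
  have "extendable ?N (\<lambda>_. 0) 0 e"
    using assms
    by (rule extendable_if_coherent[of _ _ _ _ "[]"]) (simp_all add: coherent_def dangling)
  then obtain g where g: "\<And>I. I \<in> V \<Longrightarrow> g I \<in> {..<?N} \<times> {..<k}"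
    "\<And>I J. I \<in> V \<Longrightarrow> J \<in> V \<Longrightarrow> overlap I J \<Longrightarrow> g I \<noteq> g J"
    unfolding extendable_def extension_def inside by blast
  obtain h where h: "bij_betw h ({..<?N} \<times> {..<k}) {0..<?N * k}"
    using ex_bij_betw_finite_nat[of "{..<?N} \<times> {..<k}"] by auto
  have "(h \<circ> g) I < d * k * (k + 2)" if "I \<in> V" for I
    using bij_betw_apply[OF h g(1)[OF that]] by (simp add: algebra_simps)
  moreover have "(h \<circ> g) I \<noteq> (h \<circ> g) J" if "I \<in> V" "J \<in> V" "overlap I J" for I J
    using bij_betw_imp_inj_on[OF h] g that by (auto dest: inj_onD)
  ultimately show ?thesis by blast
qed

end

subsection \<open>Points on a circle\<close>

definition circle_point :: "complex \<Rightarrow> real \<Rightarrow> real \<Rightarrow> complex" where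
  "circle_point c r t = c + rcis r t"

definition signed_area2 :: "complex \<Rightarrow> complex \<Rightarrow> complex \<Rightarrow> real" where
  "signed_area2 p q z = Im (cnj (q - p) * (z - p))"

lemma signed_area2_degenerate [simp]: "signed_area2 p q p = 0" "signed_area2 p q q = 0"
  by (simp_all add: signed_area2_def algebra_simps)

lemma signed_area2_convex_combination:
  "signed_area2 p q ((1 - u) *\<^sub>R y + u *\<^sub>R z) =
     (1 - u) * signed_area2 p q y + u * signed_area2 p q z"
  by (simp add: signed_area2_def algebra_simps)

lemma signed_area2_circle_point:
  "signed_area2 (circle_point c r a) (circle_point c r b) (circle_point c r t) =
     4 * r\<^sup>2 * sin ((b - a) / 2) * sin ((t - b) / 2) * sin ((t - a) / 2)"
proof -
  have minus_half: "sin ((a - x) / 2) = - sin ((x - a) / 2)" for x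
    by (metis minus_diff_eq minus_divide_left sin_minus)
  have half_diff: "(t + a) / 2 - (b + a) / 2 = (t - b) / 2"
    by (simp add: field_simps)
  have "signed_area2 (circle_point c r a) (circle_point c r b) (circle_point c r t) =
      r\<^sup>2 * ((cos b - cos a) * (sin t - sin a) - (sin b - sin a) * (cos t - cos a))"
    by (simp add: signed_area2_def circle_point_def algebra_simps power2_eq_square)
  also have "\<dots> = 4 * r\<^sup>2 * sin ((b - a) / 2) *
      sin ((t + a) / 2 - (b + a) / 2) * sin ((t - a) / 2)"
    unfolding sin_diff_sin cos_diff_cos minus_half sin_diff[of "(t + a) / 2"]
    by (simp add: algebra_simps)
  finally show ?thesis
    unfolding half_diff .
qed

lemma sgn_sin_eq_sgn:
  fixes x :: real
  assumes "\<bar>x\<bar> < pi"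
  shows "sgn (sin x) = sgn x"
  using assms sin_gt_zero[of x] sin_gt_zero[of "- x"]
  by (cases x "0::real" rule: linorder_cases) auto

lemma sgn_signed_area2_circle_point:
  assumes "r \<noteq> 0" "{a, b, t} \<subseteq> {0..<2 * pi}"
  shows "sgn (signed_area2 (circle_point c r a) (circle_point c r b) (circle_point c r t)) =
    sgn (b - a) * sgn (t - b) * sgn (t - a)"
proof -
  have "sgn (sin ((x - y) / 2)) = sgn (x - y)" if "x \<in> {0..<2 * pi}" "y \<in> {0..<2 * pi}" for x y
    using that sgn_sin_eq_sgn[of "(x - y) / 2"] by (simp add: sgn_divide abs_less_iff)
  moreover have "sgn (4 * r\<^sup>2) = 1"
    using assms(1) by (simp add: sgn_1_pos)
  ultimately show ?thesis
    unfolding signed_area2_circle_point sgn_mult[of "_ * _"] using assms(2) by (simp add: sgn_mult)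
qed

lemma signed_area2_circle_point_pos:
  assumes "r \<noteq> 0" "0 \<le> a" "a < b" "b < t" "t < 2 * pi"
  shows "0 < signed_area2 (circle_point c r a) (circle_point c r b) (circle_point c r t)"
  using sgn_signed_area2_circle_point[of r a b t c] assms by (simp add: sgn_1_pos)

lemma inj_on_circle_point:
  assumes "r \<noteq> 0"
  shows "inj_on (circle_point c r) {0..<2 * pi}"
proof (rule linorder_inj_onI)
  fix a b assume "a < b" "a \<in> {0..<2 * pi}" "b \<in> {0..<2 * pi}"
  then have "0 < signed_area2
      (circle_point c r a) (circle_point c r ((a + b) / 2)) (circle_point c r b)"
    using assms by (intro signed_area2_circle_point_pos) auto
  then show "circle_point c r a \<noteq> circle_point c r b"
    by auto
qed auto

lemma circle_point_Arg2pi: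
  assumes "z \<in> sphere c r"
  shows "circle_point c r (Arg2pi (z - c)) = z"
proof -
  have "cmod (z - c) = r"
    using assms by (simp add: dist_norm norm_minus_commute)
  then show ?thesis
    using Arg2pi_eq[of "z - c"] by (simp add: circle_point_def rcis_def cis_conv_exp algebra_simps)
qed

lemma open_segments_meet_if_interleaved:
  assumes "r \<noteq> 0" "0 \<le> a" "a < x" "x < b" "b < y" "y < 2 * pi"
  shows "open_segment (circle_point c r a) (circle_point c r b) \<inter>
     open_segment (circle_point c r x) (circle_point c r y) \<noteq> {}"
proof -
  let ?P = "circle_point c r"
  define wa where "wa = signed_area2 (?P x) (?P b) (?P y)"
  define wb where "wb = signed_area2 (?P a) (?P x) (?P y)"
  define wx where "wx = signed_area2 (?P a) (?P b) (?P y)"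
  define wy where "wy = signed_area2 (?P a) (?P x) (?P b)"
  have pos: "wa > 0" "wb > 0" "wx > 0" "wy > 0"
    unfolding wa_def wb_def wx_def wy_def
    using assms by (auto intro!: signed_area2_circle_point_pos)
  have sum: "wa + wb = wx + wy"
    by (simp add: wa_def wb_def wx_def wy_def signed_area2_def algebra_simps)
  have eq: "wa *\<^sub>R ?P a + wb *\<^sub>R ?P b = wx *\<^sub>R ?P x + wy *\<^sub>R ?P y"
    by (rule complex_eqI; simp add: wa_def wb_def wx_def wy_def signed_area2_def algebra_simps)
  have in_open_segment: "(1 / (v + w)) *\<^sub>R (v *\<^sub>R p + w *\<^sub>R q) \<in> open_segment p q"
    if "v > 0" "w > 0" "p \<noteq> q" for v w and p q :: complex
    unfolding in_segment using that
    by (intro conjI exI[of _ "w / (v + w)"]) (auto simp: field_simps scaleR_right_distrib)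
  have "?P a \<noteq> ?P b" "?P x \<noteq> ?P y"
    using inj_onD[OF inj_on_circle_point[OF assms(1)]] assms by fastforce+
  then show ?thesis
    using in_open_segment[of wa wb "?P a" "?P b"] in_open_segment[of wx wy "?P x" "?P y"] pos sum eq
    by auto
qed

lemma sgn_eq_minus_sgn_if_convex_combination_eq_0:
  fixes p q u :: real
  assumes "(1 - u) * p + u * q = 0" "0 < u" "u < 1"
  shows "sgn p = - sgn q"
proof -
  have "sgn ((1 - u) * p) = sgn (- (u * q))"
    using assms(1) by (intro arg_cong[of _ _ sgn]) linarith
  then show ?thesis
    using assms(2,3) by (simp add: sgn_mult sgn_minus)
qed

lemma open_segments_meet_iff_interleaved:
  assumes "r \<noteq> 0" "0 \<le> a" "a < b" "b < 2 * pi" "0 \<le> x" "x < y" "y < 2 * pi" "(a, b) \<noteq> (x, y)"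
  shows "open_segment (circle_point c r a) (circle_point c r b) \<inter>
     open_segment (circle_point c r x) (circle_point c r y) \<noteq> {} \<longleftrightarrow> interleaved a b x y"
    (is "?meet \<longleftrightarrow> _")
proof
  assume "interleaved a b x y"
  then show ?meet
    using assms open_segments_meet_if_interleaved[of r a x b y c]
      open_segments_meet_if_interleaved[of r x a y b c] by (auto simp: interleaved_def Int_commute)
next
  let ?P = "circle_point c r"
  let ?area = "signed_area2 (?P a) (?P b)"
  assume ?meet
  then obtain z where "z \<in> open_segment (?P a) (?P b)" "z \<in> open_segment (?P x) (?P y)"
    by blast
  then obtain u v where z: "z = (1 - u) *\<^sub>R ?P a + u *\<^sub>R ?P b" "z = (1 - v) *\<^sub>R ?P x + v *\<^sub>R ?P y"
    and v: "0 < v" "v < 1"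
    unfolding in_segment by blast
  have "(1 - v) * ?area (?P x) + v * ?area (?P y) = ?area z"
    unfolding z(2) by (rule signed_area2_convex_combination[symmetric])
  also have "\<dots> = 0"
    unfolding z(1) signed_area2_convex_combination by simp
  finally have "sgn (?area (?P x)) = - sgn (?area (?P y))"
    using v by (rule sgn_eq_minus_sgn_if_convex_combination_eq_0)
  then have "sgn (x - b) * sgn (x - a) = - (sgn (y - b) * sgn (y - a))"
    using assms by (simp add: sgn_signed_area2_circle_point)
  then show "interleaved a b x y"
    using assms by (auto simp: interleaved_def sgn_if split: if_splits)
qed

lemma chord_angles:
  assumes "chord c r X"
  obtains a b where "0 \<le> a" "a < b" "b < 2 * pi"
    "X = closed_segment (circle_point c r a) (circle_point c r b)"
proof -
  obtain p q where pq: "p \<in> sphere c r" "q \<in> sphere c r" "p \<noteq> q" "X = closed_segment p q"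
    using assms by (auto simp: chord_def)
  define a b where "a = Arg2pi (p - c)" and "b = Arg2pi (q - c)"
  have points: "circle_point c r a = p" "circle_point c r b = q"
    using pq(1,2) by (simp_all only: a_def b_def circle_point_Arg2pi)
  have "0 \<le> a" "a < 2 * pi" "0 \<le> b" "b < 2 * pi"
    unfolding a_def b_def by (simp_all add: Arg2pi_ge_0 Arg2pi_lt_2pi)
  moreover have "a < b \<or> b < a"
    using points pq(3) by (metis linorder_neqE)
  ultimately show ?thesis
    using that[of a b] that[of b a] points pq(4) closed_segment_commute by metis
qed

lemma crossing_iff_interleaved_angles:
  assumes "r \<noteq> 0" "\<And>X. X \<in> A \<Longrightarrow> chord c r X"
  obtains lo hi :: "complex set \<Rightarrow> real" where "\<And>X. X \<in> A \<Longrightarrow> lo X < hi X"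
    "inj_on (\<lambda>X. (lo X, hi X)) A"
    "\<And>X Y. X \<in> A \<Longrightarrow> Y \<in> A \<Longrightarrow> X \<noteq> Y \<Longrightarrow>
      cross X Y \<longleftrightarrow> interleaved (lo X) (hi X) (lo Y) (hi Y)"
proof -
  let ?P = "circle_point c r"
  have "\<forall>X\<in>A. \<exists>a b. 0 \<le> a \<and> a < b \<and> b < 2 * pi \<and> X = closed_segment (?P a) (?P b)"
    using chord_angles[OF assms(2)] by metis
  then obtain lo hi where angles: "\<And>X. X \<in> A \<Longrightarrow> 0 \<le> lo X" "\<And>X. X \<in> A \<Longrightarrow> lo X < hi X"
    "\<And>X. X \<in> A \<Longrightarrow> hi X < 2 * pi" "\<And>X. X \<in> A \<Longrightarrow> X = closed_segment (?P (lo X)) (?P (hi X))"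
    by metis
  have inj: "inj_on (\<lambda>X. (lo X, hi X)) A"
    using angles(4) by (intro inj_onI) (metis prod.inject)
  have interior: "rel_interior X = open_segment (?P (lo X)) (?P (hi X))" if "X \<in> A" for X
  proof -
    have "?P (lo X) \<noteq> ?P (hi X)"
      using inj_onD[OF inj_on_circle_point[OF assms(1)]] angles(1-3)[OF that] by fastforce
    then show ?thesis
      using angles(4)[OF that] rel_interior_closed_segment by metis
  qed
  have "cross X Y \<longleftrightarrow> interleaved (lo X) (hi X) (lo Y) (hi Y)"
    if XY: "X \<in> A" "Y \<in> A" "X \<noteq> Y" for X Y
  proof -
    have "(lo X, hi X) \<noteq> (lo Y, hi Y)"
      using inj_onD[OF inj _ XY(1,2)] XY(3) by blast
    then show ?thesis
      unfolding cross_def interior[OF XY(1)] interior[OF XY(2)]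
      by (intro open_segments_meet_iff_interleaved assms(1) angles XY)
  qed
  then show ?thesis
    using that angles(2) inj by blast
qed

subsection \<open>Separating shared endpoints\<close>

text \<open>A pair consists of an endpoint and the other endpoint of the same interval. Inverting the signed
  length makes, at a common point, intervals end before others start, longer intervals start earlier,
  and longer intervals end later. This pulls shared endpoints apart without changing which intervals
  interleave.\<close>

definition endpoint_before :: "real \<times> real \<Rightarrow> real \<times> real \<Rightarrow> bool" where
  "endpoint_before p q \<longleftrightarrow>
     fst p < fst q \<or> fst p = fst q \<and> inverse (snd p - fst p) < inverse (snd q - fst q)"

lemma endpoint_before_strict_total_order:
  "transp_on T endpoint_before" "irreflp_on T endpoint_before" "totalp_on T endpoint_before"
proof -
  show "totalp_on T endpoint_before"
  proof (rule totalp_onI)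
    fix p q :: "real \<times> real"
    assume "p \<noteq> q"
    then have "fst p \<noteq> fst q \<or> inverse (snd p - fst p) \<noteq> inverse (snd q - fst q)"
      by (auto simp: prod_eq_iff)
    then show "endpoint_before p q \<or> endpoint_before q p"
      unfolding endpoint_before_def by linarith
  qed
qed (auto simp: transp_on_def irreflp_on_def endpoint_before_def)

lemma endpoint_before_interval_iff:
  assumes "a < b" "x < y"
  shows "endpoint_before (a, b) (x, y) \<longleftrightarrow> a < x \<or> a = x \<and> y < b"
    and "endpoint_before (b, a) (y, x) \<longleftrightarrow> b < y \<or> b = y \<and> x < a"
    and "endpoint_before (a, b) (y, x) \<longleftrightarrow> a < y"
proof -
  show "endpoint_before (a, b) (x, y) \<longleftrightarrow> a < x \<or> a = x \<and> y < b"
    using assms by (auto simp: endpoint_before_def)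
  show "endpoint_before (b, a) (y, x) \<longleftrightarrow> b < y \<or> b = y \<and> x < a"
    using assms by (auto simp: endpoint_before_def)
  have "inverse (x - y) < 0" "0 < inverse (b - a)"
    using assms by simp_all
  then show "endpoint_before (a, b) (y, x) \<longleftrightarrow> a < y"
    unfolding endpoint_before_def fst_conv snd_conv by linarith
qed

lemma interval_system_if_intervals:
  fixes lo hi :: "'a \<Rightarrow> real"
  assumes "finite A" and less: "\<And>X. X \<in> A \<Longrightarrow> lo X < hi X" and inj: "inj_on (\<lambda>X. (lo X, hi X)) A"
  obtains l r :: "'a \<Rightarrow> nat" where "interval_system A l r"
    "\<And>X Y. X \<in> A \<Longrightarrow> Y \<in> A \<Longrightarrow>
      interleaved (l X) (r X) (l Y) (r Y) \<longleftrightarrow> interleaved (lo X) (hi X) (lo Y) (hi Y)"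
proof -
  define E where "E = (\<lambda>X. (lo X, hi X)) ` A \<union> (\<lambda>X. (hi X, lo X)) ` A"
  have "finite E"
    using assms(1) by (simp add: E_def)
  then obtain rank :: "real \<times> real \<Rightarrow> nat" where rank: "inj_on rank E"
    "\<And>p q. p \<in> E \<Longrightarrow> q \<in> E \<Longrightarrow> rank p < rank q \<longleftrightarrow> endpoint_before p q"
    using strict_total_order_rank[OF _ endpoint_before_strict_total_order] by metis
  define l r where "l X = rank (lo X, hi X)" and "r X = rank (hi X, lo X)" for X
  have E: "(lo X, hi X) \<in> E" "(hi X, lo X) \<in> E" if "X \<in> A" for X
    using that by (auto simp: E_def)
  note order = rank(2)[OF E(1) E(1)] rank(2)[OF E(2) E(2)] rank(2)[OF E(1) E(2)]
  show ?thesis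
  proof
    show "interval_system A l r"
    proof
      show "l X < r X" if "X \<in> A" for X
        using order(3)[OF that that] less[OF that] by (simp add: l_def r_def endpoint_before_def)
      show "inj_on l A" "inj_on r A"
        using inj E unfolding l_def r_def inj_on_def by (simp_all add: inj_on_eq_iff[OF rank(1)])
      show "l X \<noteq> r Y" if "X \<in> A" "Y \<in> A" for X Y
        using less[OF that(1)] less[OF that(2)] E that
        by (auto simp: l_def r_def inj_on_eq_iff[OF rank(1)])
    qed (rule assms(1))
    show "interleaved (l X) (r X) (l Y) (r Y) \<longleftrightarrow> interleaved (lo X) (hi X) (lo Y) (hi Y)"
      if XY: "X \<in> A" "Y \<in> A" for X Y
      unfolding interleaved_def l_def r_def order[OF XY] order[OF XY(2,1)]
        endpoint_before_interval_iff[OF less[OF XY(1)] less[OF XY(2)]]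
        endpoint_before_interval_iff[OF less[OF XY(2)] less[OF XY(1)]] by linarith
  qed
qed

subsection \<open>Circle graphs\<close>

lemma colorable_circle_graphI:
  assumes "\<And>X. X \<in> A \<Longrightarrow> f X < n"
    and "\<And>X Y. X \<in> A \<Longrightarrow> Y \<in> A \<Longrightarrow> X \<noteq> Y \<Longrightarrow> cross X Y \<Longrightarrow> f X \<noteq> f Y"
  shows "colorable (with_proj (circle_graph A)) n"
proof -
  have "proper_coloring (with_proj (circle_graph A)) f"
    using assms(2)
    by (auto simp: proper_coloring_def circle_graph_def arcs_ends_def arc_to_ends_def)
  moreover have "f ` verts (with_proj (circle_graph A)) \<subseteq> {..<n}"
    using assms(1) by (auto simp: circle_graph_def)
  ultimately show ?thesis
    unfolding colorable_def by blast
qed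

lemma chromatic_number_le: "colorable G n \<Longrightarrow> chromatic_number G \<le> n"
  unfolding chromatic_number_def by (rule Least_le)

lemma complete_subgraph_if_pairwise_cross:
  assumes "finite A" "B \<subseteq> A" "pairwise cross B"
  shows "\<exists>H. subgraph H (with_proj (circle_graph A)) \<and> complete_digraph (card B) H"
proof -
  interpret pair_graph "circle_graph A"
    using pair_graph_circle_graph[OF assms(1)] .
  define H :: "complex set pair_pre_digraph" where
    "H = \<lparr> pverts = B, parcs = {(X, Y). (X, Y) \<in> B \<times> B \<and> X \<noteq> Y} \<rparr>"
  have "complete_digraph (card B) (with_proj H)"
    unfolding complete_digraph_pair_def using assms(1,2) by (simp add: H_def finite_subset)
  moreover have "subgraph (with_proj H) (with_proj (circle_graph A))"
  proof (rule subgraphI)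
    show "wf_digraph (with_proj H)" by unfold_locales (auto simp: H_def)
    show "wf_digraph (with_proj (circle_graph A))" by unfold_locales
  qed (use assms in \<open>auto simp: H_def circle_graph_def compatible_def pairwise_def\<close>)
  ultimately show ?thesis by blast
qed

lemma card_pairwise_cross_le:
  assumes "finite A" "\<not> (\<exists>H. subgraph H (with_proj (circle_graph A)) \<and> complete_digraph (Suc k) H)"
    and "C \<subseteq> A" "pairwise cross C"
  shows "card C \<le> k"
proof (rule ccontr)
  assume "\<not> card C \<le> k"
  then obtain B where "B \<subseteq> C" "card B = Suc k"
    using obtain_subset_with_card_n[of "Suc k" C] by auto
  then have "B \<subseteq> A" "pairwise cross B"
    using assms(3,4) pairwise_subset by auto
  then show False
    using complete_subgraph_if_pairwise_cross[OF assms(1)] \<open>card B = Suc k\<close> assms(2) by metis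
qed

theorem circle_graph_colorable:
  assumes "r \<noteq> 0" "finite A" "\<And>X. X \<in> A \<Longrightarrow> chord c r X"
    and "\<not> (\<exists>H. subgraph H (with_proj (circle_graph A)) \<and> complete_digraph (Suc k) H)"
    and "Suc k \<le> 2 ^ d"
  shows "colorable (with_proj (circle_graph A)) (d * k * (k + 2))"
proof -
  obtain lo hi :: "complex set \<Rightarrow> real" where angles: "\<And>X. X \<in> A \<Longrightarrow> lo X < hi X"
    "inj_on (\<lambda>X. (lo X, hi X)) A"
    and cross: "\<And>X Y. X \<in> A \<Longrightarrow> Y \<in> A \<Longrightarrow> X \<noteq> Y \<Longrightarrow>
      cross X Y \<longleftrightarrow> interleaved (lo X) (hi X) (lo Y) (hi Y)"
    using crossing_iff_interleaved_angles[OF assms(1,3)] by blast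
  obtain l u :: "complex set \<Rightarrow> nat" where "interval_system A l u"
    and interleaved: "\<And>X Y. X \<in> A \<Longrightarrow> Y \<in> A \<Longrightarrow>
      interleaved (l X) (u X) (l Y) (u Y) \<longleftrightarrow> interleaved (lo X) (hi X) (lo Y) (hi Y)"
    using interval_system_if_intervals[OF assms(2) angles] by blast
  then interpret interval_system A l u
    by simp
  have overlap_iff_cross: "overlap X Y \<longleftrightarrow> cross X Y" if "X \<in> A" "Y \<in> A" "X \<noteq> Y" for X Y
    using cross[OF that] interleaved[OF that(1,2)] by (simp add: overlap_def)
  interpret clique_bounded_interval_system A l u k
  proof
    fix C assume C: "C \<subseteq> A" "pairwise overlap C"
    then have "pairwise cross C"
      using overlap_iff_cross by (simp add: pairwise_def subset_iff)
    then show "card C \<le> k"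
      using card_pairwise_cross_le[OF assms(2,4)] C(1) by blast
  qed
  obtain f :: "complex set \<Rightarrow> nat" where "\<forall>X\<in>A. f X < d * k * (k + 2)"
    "\<forall>X\<in>A. \<forall>Y\<in>A. overlap X Y \<longrightarrow> f X \<noteq> f Y"
    using ex_interval_coloring[OF assms(5)] by blast
  then show ?thesis
    using overlap_iff_cross by (intro colorable_circle_graphI[of A f]) blast+
qed

theorem theorem1:
  fixes c :: complex and r :: real and A :: "complex set set"
  assumes "r > 0"
    and "finite A"
    and "\<forall>X\<in>A. chord c r X"
    and "\<not> (\<exists>H. subgraph H (with_proj (circle_graph A)) \<and> complete_digraph 4 H)"
  shows "colorable (with_proj (circle_graph A)) 30
    \<and> chromatic_number (with_proj (circle_graph A)) \<le> 30"
proof -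
  have "colorable (with_proj (circle_graph A)) (2 * 3 * (3 + 2))"
    using assms by (intro circle_graph_colorable[of r]) auto
  then show ?thesis
    using chromatic_number_le by simp
qed

end
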